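(* For a user $u$ with interacted item $i$, the expected change in the item's (squared) magnitude after the $k$-th gradient descent step, $\mathbb{E}[\Delta\|\mathbf{i}^{(k+1)}\|^{2}]$, when trained with asymmetric updates of cosine similarity and weight decay, is expressed as $$\mathbb{E}[\Delta\|\mathbf{i}^{(k+1)}\|^{2}] = \underbrace{\mathbb{E}[\|\mathbf{i}^{(k)}\|^2]\,\eta\lambda(\eta\lambda-2)}_{\text{Weight Decay Contribution}} + \underbrace{\left(1-\left(1-\frac{|B|}{|E|}\right)^{d_i}\right)}_{P(i\in B)}\ \underbrace{\mathbb{E}\left[\frac{\eta^{2}}{\|\mathbf{i}^{(k)}\|^{2}}\left(1-\frac{(\mathbf{u}^{(k)}\cdot\mathbf{i}^{(k)})^2}{\|\mathbf{u}^{(k)}\|^2\,\|\mathbf{i}^{(k)}\|^2}\right)\right]}_{\text{Ranking Loss Contribution}}.$$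
   Context: Setting: collaborative filtering with a set $E$ of historical user-item interactions. Each user $u$ and each item $i$ has an embedding vector $\mathbf{u},\mathbf{i}\in\mathbb{R}^d$; $\mathbf{u}^{(k)},\mathbf{i}^{(k)}$ denote the embeddings at the $k$-th gradient descent step, $\|\cdot\|$ is the Euclidean norm, and $\mathbb{E}[\Delta\|\mathbf{i}^{(k+1)}\|^2]$ is the difference $\mathbb{E}[\|\mathbf{i}^{(k+1)}\|^2]-\mathbb{E}[\|\mathbf{i}^{(k)}\|^2]$. The number $d_i$ is the number of interactions of item $i$ (its popularity, i.e. its degree in the interaction graph). The embeddings are trained by mini-batch gradient descent with learning rate $\eta$ and weight decay strength $\lambda$. The ranking loss is applied to batches $B$ of interactions, with $|B|\le|E|$, and is the cosine similarity loss, so that the full loss for a batch $B$ is $$L=-\sum_{(u,i)\in B}\frac{\mathbf{u}\cdot\mathbf{i}}{\|\mathbf{u}\|\,\|\mathbf{i}\|}+\frac{\lambda}{2}\left(\sum_u\|\mathbf{u}\|^2+\sum_i\|\mathbf{i}\|^2\right),$$ where the weight decay sums run over the full embedding tables (all users and all items). "Asymmetric updates" means that an item included in the batch (written $i\in B$) receives gradient updates from both the ranking loss and weight decay, whereas an item not in the batch receives an update from weight decay only. The probability that item $i$ appears in a batch $B$ is given by $P(i\in B)=1-\left(1-\frac{|B|}{|E|}\right)^{d_i}$.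
   Formalization: The formal statement adds that whenever i is in the batch, its only interaction there is with u (u may be random), and that the event i∈B is independent of the pair (u^(k), i^(k)); without these the formula fails. Embeddings are a.s. non-zero and the squared magnitudes have finite expectation. *)

theory Defs
  imports "HOL-Probability.Probability"
begin

(* Embedding tables are total functions on finite types of users and items, so
   the weight decay sums range over the full tables whatever the batch is. *)
definition batch_loss ::
  "real \<Rightarrow> ('user::finite \<times> 'item::finite) set \<Rightarrow>
   ('user \<Rightarrow> real ^ 'd) \<Rightarrow> ('item \<Rightarrow> real ^ 'd) \<Rightarrow> real" where
  "batch_loss lam B U I =
     - (\<Sum>(u, i)\<in>B. (U u \<bullet> I i) / (norm (U u) * norm (I i)))
     + lam / 2 * ((\<Sum>u\<in>UNIV. (norm (U u))\<^sup>2) + (\<Sum>i\<in>UNIV. (norm (I i))\<^sup>2))"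

(* Unspecified at points where f is not differentiable; for the batch loss this
   can only happen at a zero embedding. *)
definition grad :: "(real ^ 'd \<Rightarrow> real) \<Rightarrow> real ^ 'd \<Rightarrow> real ^ 'd" where
  "grad f x = (THE D. GDERIV f x :> D)"

(* One gradient descent step, taken simultaneously in all embeddings. An item i
   outside the batch occurs in the loss only through its weight decay term, so
   the asymmetry of the updates is a consequence of the form of the loss. *)
definition user_step ::
  "real \<Rightarrow> real \<Rightarrow> ('user::finite \<times> 'item::finite) set \<Rightarrow>
   ('user \<Rightarrow> real ^ 'd) \<Rightarrow> ('item \<Rightarrow> real ^ 'd) \<Rightarrow> 'user \<Rightarrow> real ^ 'd" where
  "user_step eta lam B U I u =
     U u - eta *\<^sub>R grad (\<lambda>x. batch_loss lam B (U(u := x)) I) (U u)"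

definition item_step ::
  "real \<Rightarrow> real \<Rightarrow> ('user::finite \<times> 'item::finite) set \<Rightarrow>
   ('user \<Rightarrow> real ^ 'd) \<Rightarrow> ('item \<Rightarrow> real ^ 'd) \<Rightarrow> 'item \<Rightarrow> real ^ 'd" where
  "item_step eta lam B U I i =
     I i - eta *\<^sub>R grad (\<lambda>x. batch_loss lam B U (I(i := x))) (I i)"

definition batch_items :: "('user \<times> 'item) set \<Rightarrow> 'item set" where
  "batch_items B = snd ` B"

definition item_degree :: "('user \<times> 'item) set \<Rightarrow> 'item \<Rightarrow> nat" where
  "item_degree E i = card {u. (u, i) \<in> E}"

(* E: historical interactions, b: batch size, batch k: the random batch used to
   pass from step k to step k + 1, U k and I k: the random embedding tables
   after k steps. No law is fixed for the initial tables or for the batches. *)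
locale minibatch_training = prob_space M
  for M :: "'w measure" +
  fixes E :: "('user::finite \<times> 'item::finite) set"
    and b :: nat
    and batch :: "nat \<Rightarrow> 'w \<Rightarrow> ('user \<times> 'item) set"
    and U :: "nat \<Rightarrow> 'w \<Rightarrow> 'user \<Rightarrow> real ^ 'd"
    and I :: "nat \<Rightarrow> 'w \<Rightarrow> 'item \<Rightarrow> real ^ 'd"
    and eta lam :: real
  assumes batch_size_le: "b \<le> card E"
    and batch_measurable: "\<And>k. batch k \<in> measurable M (count_space UNIV)"
    and batch_subset: "\<And>k \<omega>. \<omega> \<in> space M \<Longrightarrow> batch k \<omega> \<subseteq> E"
    and batch_card: "\<And>k \<omega>. \<omega> \<in> space M \<Longrightarrow> card (batch k \<omega>) = b"
    and user_measurable: "\<And>k u. (\<lambda>\<omega>. U k \<omega> u) \<in> borel_measurable M"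
    and item_measurable: "\<And>k i. (\<lambda>\<omega>. I k \<omega> i) \<in> borel_measurable M"
    and user_update: "\<And>k \<omega> u. \<omega> \<in> space M \<Longrightarrow>
          U (Suc k) \<omega> u = user_step eta lam (batch k \<omega>) (U k \<omega>) (I k \<omega>) u"
    and item_update: "\<And>k \<omega> i. \<omega> \<in> space M \<Longrightarrow>
          I (Suc k) \<omega> i = item_step eta lam (batch k \<omega>) (U k \<omega>) (I k \<omega>) i"

end

theory Submission
  imports Defs
begin

text \<open>
  The gradient of the cosine similarity with respect to the item is orthogonal to the item, so in
  the squared norm of the updated item the weight decay and the ranking part add without a cross
  term, and the ranking part occurs exactly on the event that the item is in the batch.
  Independence factors the expectation of that part. The factorisation is done for
  Lebesgue integrals of nonnegative functions, so that it also covers an item which is never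
  drawn and whose ranking contribution need not be integrable.
\<close>

lemma grad_eq:
  assumes "GDERIV f x :> D"
  shows "grad f x = D"
  unfolding grad_def
proof (rule the_equality)
  fix D' assume "GDERIV f x :> D'"
  then have "(\<lambda>h. h \<bullet> D') = (\<lambda>h. h \<bullet> D)"
    using assms unfolding gderiv_def by (rule has_derivative_unique)
  then have "h \<bullet> (D' - D) = 0" for h
    by (metis inner_diff_right right_minus_eq)
  then show "D' = D"
    by (metis inner_eq_zero_iff right_minus_eq)
qed (fact assms)

text \<open>For nonzero \<open>a\<close> and \<open>x\<close> this is the component of the unit
  vector \<open>a / norm a\<close> orthogonal to \<open>x\<close>, divided by \<open>norm x\<close>.
  At \<open>a = 0\<close> it is zero.\<close>

definition cosine_grad :: "real ^ 'd \<Rightarrow> real ^ 'd \<Rightarrow> real ^ 'd" where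
  "cosine_grad a x =
     (1 / (norm a * norm x)) *\<^sub>R a - ((a \<bullet> x) / (norm a * norm x ^ 3)) *\<^sub>R x"

text \<open>The case \<open>a = 0\<close> is included because a batch may contain other users with
  zero embedding. There the quotient is constantly 0 by division by zero.\<close>

lemma GDERIV_cosine:
  fixes a x :: "real ^ 'd"
  assumes "x \<noteq> 0"
  shows "GDERIV (\<lambda>y. (a \<bullet> y) / (norm a * norm y)) x :> cosine_grad a x"
proof (cases "a = 0")
  case True
  then show ?thesis
    by (simp add: cosine_grad_def GDERIV_const)
next
  case False
  have "((\<lambda>y. (a \<bullet> y) / (norm a * norm y)) has_derivative (\<lambda>h. h \<bullet> cosine_grad a x)) (at x)"
    using assms False has_derivative_norm[OF assms]
    by (auto intro!: derivative_eq_intros ext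
        simp: cosine_grad_def sgn_div_norm inner_diff_right inner_commute field_simps power3_eq_cube)
  then show ?thesis
    by (simp add: gderiv_def)
qed

text \<open>Scaling \<open>x\<close> by a positive factor leaves the cosine unchanged, so its
  derivative in the direction of \<open>x\<close> vanishes.\<close>

lemma inner_cosine_grad:
  assumes "x \<noteq> 0"
  shows "x \<bullet> cosine_grad a x = 0"
  using assms
  by (simp add: cosine_grad_def inner_diff_right inner_commute power3_eq_cube
      flip: power2_norm_eq_inner) (simp add: power2_eq_square)

lemma norm_cosine_grad_sq:
  assumes "a \<noteq> 0" "x \<noteq> 0"
  shows "(norm (cosine_grad a x))\<^sup>2
    = 1 / (norm x)\<^sup>2 * (1 - (a \<bullet> x)\<^sup>2 / ((norm a)\<^sup>2 * (norm x)\<^sup>2))"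
proof -
  \<comment> \<open>Only one factor of the inner square is unfolded: its part along \<open>x\<close>
    is orthogonal to the gradient, so its part along \<open>a\<close> alone remains.\<close>
  have "(norm (cosine_grad a x))\<^sup>2 = (a \<bullet> cosine_grad a x) / (norm a * norm x)"
    using inner_cosine_grad[OF assms(2), of a]
    by (simp add: power2_norm_eq_inner cosine_grad_def[of a x, THEN arg_cong[where f="\<lambda>v. v \<bullet> _"]]
        inner_diff_left)
  also have "\<dots> = 1 / (norm x)\<^sup>2 * (1 - (a \<bullet> x)\<^sup>2 / ((norm a)\<^sup>2 * (norm x)\<^sup>2))"
    using assms
    by (simp add: cosine_grad_def inner_diff_right flip: power2_norm_eq_inner)
       (simp add: field_simps power2_eq_square power3_eq_cube)
  finally show ?thesis .
qed

text \<open>As a function of the embedding of \<open>i\<close>, the loss is a constant plus a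
  quadratic decay term minus one cosine for each user paired with \<open>i\<close> in the batch. If
  there is no such user, the sum is empty and only decay acts.\<close>

lemma item_step_eq:
  fixes U :: "'user::finite \<Rightarrow> real ^ 'd" and I :: "'item::finite \<Rightarrow> real ^ 'd"
  assumes "I i \<noteq> 0"
  shows "item_step eta lam B U I i
    = (1 - eta * lam) *\<^sub>R I i + eta *\<^sub>R (\<Sum>v | (v, i) \<in> B. cosine_grad (U v) (I i))"
proof -
  define V where "V = {v. (v, i) \<in> B}"
  \<comment> \<open>\<open>c\<close> gathers the cosines of pairs with other items and the decay
    terms of everything except item \<open>i\<close>; these have zero gradient in the embedding of
    \<open>i\<close>.\<close>
  define c where "c = - (\<Sum>(v, j)\<in>B - V \<times> {i}. (U v \<bullet> I j) / (norm (U v) * norm (I j)))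
    + lam / 2 * ((\<Sum>v\<in>UNIV. (norm (U v))\<^sup>2) + (\<Sum>j\<in>-{i}. (norm (I j))\<^sup>2))"
  have loss: "batch_loss lam B U (I(i := x))
    = c + lam / 2 * (x \<bullet> x) - (\<Sum>v\<in>V. (U v \<bullet> x) / (norm (U v) * norm x))" for x
  proof -
    have "(\<Sum>(v, j)\<in>B. (U v \<bullet> (I(i := x)) j) / (norm (U v) * norm ((I(i := x)) j)))
      = (\<Sum>(v, j)\<in>B - V \<times> {i}. (U v \<bullet> (I(i := x)) j) / (norm (U v) * norm ((I(i := x)) j)))
      + (\<Sum>(v, j)\<in>V \<times> {i}. (U v \<bullet> (I(i := x)) j) / (norm (U v) * norm ((I(i := x)) j)))"
      by (rule sum.subset_diff) (auto simp: V_def)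
    also have "(\<Sum>(v, j)\<in>B - V \<times> {i}. (U v \<bullet> (I(i := x)) j) / (norm (U v) * norm ((I(i := x)) j)))
      = (\<Sum>(v, j)\<in>B - V \<times> {i}. (U v \<bullet> I j) / (norm (U v) * norm (I j)))"
      by (rule sum.cong) (auto simp: V_def split: if_splits)
    also have "(\<Sum>(v, j)\<in>V \<times> {i}. (U v \<bullet> (I(i := x)) j) / (norm (U v) * norm ((I(i := x)) j)))
      = (\<Sum>v\<in>V. (U v \<bullet> x) / (norm (U v) * norm x))"
      by (simp flip: sum.cartesian_product)
    finally have rank: "(\<Sum>(v, j)\<in>B. (U v \<bullet> (I(i := x)) j) / (norm (U v) * norm ((I(i := x)) j)))
      = (\<Sum>(v, j)\<in>B - V \<times> {i}. (U v \<bullet> I j) / (norm (U v) * norm (I j)))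
      + (\<Sum>v\<in>V. (U v \<bullet> x) / (norm (U v) * norm x))" .
    have "(\<Sum>j\<in>UNIV. (norm ((I(i := x)) j))\<^sup>2)
      = (norm x)\<^sup>2 + (\<Sum>j\<in>-{i}. (norm ((I(i := x)) j))\<^sup>2)"
      by (simp add: sum.remove[of UNIV i] Compl_eq_Diff_UNIV)
    also have "(\<Sum>j\<in>-{i}. (norm ((I(i := x)) j))\<^sup>2) = (\<Sum>j\<in>-{i}. (norm (I j))\<^sup>2)"
      by (rule sum.cong) auto
    finally show ?thesis
      unfolding batch_loss_def rank c_def by (simp add: power2_norm_eq_inner algebra_simps)
  qed
  have "GDERIV (\<lambda>x. batch_loss lam B U (I(i := x))) (I i)
    :> lam *\<^sub>R I i - (\<Sum>v\<in>V. cosine_grad (U v) (I i))"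
    unfolding loss gderiv_def
    by (rule derivative_eq_intros GDERIV_cosine[OF assms, unfolded gderiv_def] refl)+
       (simp add: inner_diff_right inner_sum_right inner_commute)
  then show ?thesis
    unfolding item_step_def V_def by (simp add: grad_eq algebra_simps)
qed

text \<open>Independence says that the law of \<open>X\<close> under \<open>M\<close> restricted to
  \<open>A\<close> is the law of \<open>X\<close> scaled by \<open>prob A\<close>; integrating
  \<open>g\<close> against both measures gives the claim.\<close>

lemma (in prob_space) integral_indicator_times_indep:
  fixes g :: "'b \<Rightarrow> real"
  assumes A: "A \<in> events" and X: "X \<in> measurable M N" and g: "g \<in> borel_measurable N"
    and nonneg: "\<And>x. x \<in> space N \<Longrightarrow> 0 \<le> g x"
    and indep: "\<And>S. S \<in> sets N \<Longrightarrow>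
      prob (A \<inter> (X -` S \<inter> space M)) = prob A * prob (X -` S \<inter> space M)"
  shows "(LINT \<omega>|M. indicator A \<omega> * g (X \<omega>)) = prob A * (LINT \<omega>|M. g (X \<omega>))"
proof -
  have gX [measurable]: "(\<lambda>\<omega>. g (X \<omega>)) \<in> borel_measurable M"
    using X g by measurable
  note [measurable] = A
  have g_nonneg: "AE \<omega> in M. 0 \<le> g (X \<omega>)"
    using X by (auto intro!: AE_I2 nonneg dest: measurable_space)
  have restrict: "distr (density M (indicator A)) N X = scale_measure (ennreal (prob A)) (distr M N X)"
  proof (rule measure_eqI)
    fix S assume "S \<in> sets (distr (density M (indicator A)) N X)"
    then have S: "S \<in> sets N" by simp
    then have XS: "X -` S \<inter> space M \<in> events"
      using X by (rule measurable_sets[rotated])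
    have "emeasure (distr (density M (indicator A)) N X) S = emeasure M (A \<inter> (X -` S \<inter> space M))"
      using S X XS A
      by (simp add: emeasure_distr emeasure_density nn_integral_indicator flip: indicator_inter_arith)
    also have "\<dots> = emeasure (scale_measure (ennreal (prob A)) (distr M N X)) S"
      using S X by (simp add: emeasure_eq_measure indep emeasure_distr measure_distr ennreal_mult)
    finally show "emeasure (distr (density M (indicator A)) N X) S
      = emeasure (scale_measure (ennreal (prob A)) (distr M N X)) S" .
  qed simp
  have "(\<integral>\<^sup>+\<omega>. ennreal (indicator A \<omega> * g (X \<omega>)) \<partial>M)
    = (\<integral>\<^sup>+\<omega>. indicator A \<omega> * ennreal (g (X \<omega>)) \<partial>M)"
    by (intro nn_integral_cong) (simp split: split_indicator)
  also have "\<dots> = (\<integral>\<^sup>+x. ennreal (g x) \<partial>distr (density M (indicator A)) N X)"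
    using X g by (simp add: nn_integral_distr nn_integral_density)
  also have "\<dots> = ennreal (prob A) * (\<integral>\<^sup>+\<omega>. ennreal (g (X \<omega>)) \<partial>M)"
    unfolding restrict using X g by (simp add: nn_integral_scale_measure nn_integral_distr)
  \<comment> \<open>\<open>enn2real\<close> is multiplicative even at infinity, which it sends to 0,
    the value of the Bochner integral of a non-integrable function. So no integrability of
    \<open>g (X \<omega>)\<close> is required.\<close>
  finally show ?thesis
    using g_nonneg by (subst (1 2) integral_eq_nn_integral)
      (auto simp: enn2real_mult split: split_indicator)
qed

theorem theorem1:
  fixes M :: "'w measure"
    and E :: "('user::finite \<times> 'item::finite) set"
    and b k :: nat
    and batch :: "nat \<Rightarrow> 'w \<Rightarrow> ('user \<times> 'item) set"
    and U :: "nat \<Rightarrow> 'w \<Rightarrow> 'user \<Rightarrow> real ^ 'd"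
    and I :: "nat \<Rightarrow> 'w \<Rightarrow> 'item \<Rightarrow> real ^ 'd"
    and eta lam :: real
    and u :: "'w \<Rightarrow> 'user"
    and i :: 'item
  assumes training: "minibatch_training M E b batch U I eta lam"
    and u_random: "u \<in> measurable M (count_space UNIV)"
    and interacted: "\<And>\<omega>. \<omega> \<in> space M \<Longrightarrow> (u \<omega>, i) \<in> E"
    and sole_interaction: "AE \<omega> in M. i \<in> batch_items (batch k \<omega>) \<longrightarrow>
          {v. (v, i) \<in> batch k \<omega>} = {u \<omega>}"
    and batch_prob: "measure M {\<omega> \<in> space M. i \<in> batch_items (batch k \<omega>)}
          = 1 - (1 - real b / real (card E)) ^ item_degree E i"
    and indep: "prob_space.indep_set M
          {{\<omega> \<in> space M. i \<in> batch_items (batch k \<omega>)}}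
          {{\<omega> \<in> space M. (U k \<omega> (u \<omega>), I k \<omega> i) \<in> S} | S. S \<in> sets borel}"
    and user_nonzero: "AE \<omega> in M. U k \<omega> (u \<omega>) \<noteq> 0"
    and item_nonzero: "AE \<omega> in M. I k \<omega> i \<noteq> 0"
    and integrable_before: "integrable M (\<lambda>\<omega>. (norm (I k \<omega> i))\<^sup>2)"
    and integrable_after: "integrable M (\<lambda>\<omega>. (norm (I (Suc k) \<omega> i))\<^sup>2)"
  shows "(LINT \<omega>|M. (norm (I (Suc k) \<omega> i))\<^sup>2) - (LINT \<omega>|M. (norm (I k \<omega> i))\<^sup>2)
       = (LINT \<omega>|M. (norm (I k \<omega> i))\<^sup>2) * (eta * lam * (eta * lam - 2))
       + (1 - (1 - real b / real (card E)) ^ item_degree E i)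
         * (LINT \<omega>|M. eta\<^sup>2 / (norm (I k \<omega> i))\<^sup>2
              * (1 - (U k \<omega> (u \<omega>) \<bullet> I k \<omega> i)\<^sup>2
                     / ((norm (U k \<omega> (u \<omega>)))\<^sup>2 * (norm (I k \<omega> i))\<^sup>2)))"
proof -
  interpret minibatch_training M E b batch U I eta lam
    by (fact training)
  define A where "A = {\<omega> \<in> space M. i \<in> batch_items (batch k \<omega>)}"
  \<comment> \<open>The ranking contribution is the function \<open>g\<close> of this pair, so
    independence of the batch event from the joint law of user and item embedding is what is
    used.\<close>
  define X where "X = (\<lambda>\<omega>. (U k \<omega> (u \<omega>), I k \<omega> i))"
  define g :: "(real ^ 'd) \<times> (real ^ 'd) \<Rightarrow> real" where
    "g = (\<lambda>(a, x). eta\<^sup>2 / (norm x)\<^sup>2 * (1 - (a \<bullet> x)\<^sup>2 / ((norm a)\<^sup>2 * (norm x)\<^sup>2)))"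
  note [measurable] = batch_measurable user_measurable item_measurable u_random
  have A: "A \<in> events"
    unfolding A_def by measurable
  \<comment> \<open>The user is itself random, but takes values in a finite type.\<close>
  have "(\<lambda>\<omega>. U k \<omega> (u \<omega>)) \<in> borel_measurable M"
    by (rule measurable_compose_countable[OF user_measurable u_random])
  then have X: "X \<in> borel_measurable M"
    unfolding X_def by (intro borel_measurable_Pair item_measurable)
  have g: "g \<in> borel_measurable borel"
    unfolding g_def borel_prod[symmetric] by measurable
  have g_nonneg: "0 \<le> g p" for p
  proof -
    obtain a x where p: "p = (a, x)" by (cases p)
    have "(a \<bullet> x)\<^sup>2 \<le> (norm a)\<^sup>2 * (norm x)\<^sup>2"
      by (metis Cauchy_Schwarz_ineq power2_norm_eq_inner)
    then have "(a \<bullet> x)\<^sup>2 / ((norm a)\<^sup>2 * (norm x)\<^sup>2) \<le> 1"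
      by (auto simp: divide_le_eq_1 zero_less_mult_iff)
    then show ?thesis
      by (simp add: p g_def)
  qed
  have factor: "(LINT \<omega>|M. indicator A \<omega> * g (X \<omega>)) = prob A * (LINT \<omega>|M. g (X \<omega>))"
  proof (rule integral_indicator_times_indep[OF A X g g_nonneg])
    fix S :: "((real ^ 'd) \<times> (real ^ 'd)) set" assume "S \<in> sets borel"
    then have "X -` S \<inter> space M \<in> {{\<omega> \<in> space M. (U k \<omega> (u \<omega>), I k \<omega> i) \<in> S} | S. S \<in> sets borel}"
      by (auto simp: X_def)
    then show "prob (A \<inter> (X -` S \<inter> space M)) = prob A * prob (X -` S \<inter> space M)"
      using indep_setD[OF indep] by (simp add: A_def)
  qed
  have step: "AE \<omega> in M. indicator A \<omega> * g (X \<omega>)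
    = (norm (I (Suc k) \<omega> i))\<^sup>2 - (1 - eta * lam)\<^sup>2 * (norm (I k \<omega> i))\<^sup>2"
    using sole_interaction user_nonzero item_nonzero AE_space
  proof eventually_elim
    case (elim \<omega>)
    let ?x = "I k \<omega> i" and ?a = "U k \<omega> (u \<omega>)"
    have next_item: "I (Suc k) \<omega> i = (1 - eta * lam) *\<^sub>R ?x
      + eta *\<^sub>R (\<Sum>v | (v, i) \<in> batch k \<omega>. cosine_grad (U k \<omega> v) ?x)"
      using elim by (simp add: item_update item_step_eq)
    show ?case
    proof (cases "\<omega> \<in> A")
      case True
      \<comment> \<open>By \<open>sole_interaction\<close> the sum over users in the batch collapses
        to the single term of \<open>u \<omega>\<close>.\<close>
      then have "I (Suc k) \<omega> i = (1 - eta * lam) *\<^sub>R ?x + eta *\<^sub>R cosine_grad ?a ?x"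
        using elim next_item by (simp add: A_def)
      then have "(norm (I (Suc k) \<omega> i))\<^sup>2
        = (1 - eta * lam)\<^sup>2 * (norm ?x)\<^sup>2 + eta\<^sup>2 * (norm (cosine_grad ?a ?x))\<^sup>2"
        using inner_cosine_grad[of ?x ?a] elim
        by (simp add: norm_add_Pythagorean orthogonal_def power_mult_distrib)
      then show ?thesis
        using True elim by (simp add: norm_cosine_grad_sq g_def X_def)
    next
      case False
      then have "{v. (v, i) \<in> batch k \<omega>} = {}"
        using elim by (force simp: A_def batch_items_def)
      then show ?thesis
        using False next_item by (simp add: power_mult_distrib)
    qed
  qed
  have "prob A * (LINT \<omega>|M. g (X \<omega>))
    = (LINT \<omega>|M. (norm (I (Suc k) \<omega> i))\<^sup>2 - (1 - eta * lam)\<^sup>2 * (norm (I k \<omega> i))\<^sup>2)"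
    unfolding factor[symmetric]
  proof (rule integral_cong_AE[OF _ _ step])
    show "(\<lambda>\<omega>. indicator A \<omega> * g (X \<omega>)) \<in> borel_measurable M"
      using A X g by measurable
  qed measurable
  \<comment> \<open>The integral is split only on this side, where both squared norms are integrable
    by assumption.\<close>
  also have "\<dots> = (LINT \<omega>|M. (norm (I (Suc k) \<omega> i))\<^sup>2)
    - (1 - eta * lam)\<^sup>2 * (LINT \<omega>|M. (norm (I k \<omega> i))\<^sup>2)"
    using integrable_before integrable_after by simp
  finally have "prob A * (LINT \<omega>|M. g (X \<omega>)) = \<dots>" .
  \<comment> \<open>The decay term comes from
    \<open>(1 - eta * lam)\<^sup>2 - 1 = eta * lam * (eta * lam - 2)\<close>.\<close>
  then show ?thesis
    unfolding batch_prob[symmetric] A_def[symmetric]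
    by (simp add: g_def X_def power2_eq_square algebra_simps)
qed

end
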